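(* Let $\mathcal{M}$ be a simplicial surface in $\mathbb{R}^3$ with vertices $v_1,\dots,v_n$ and set of triangular faces $\mathcal{F}(\mathcal{M})$, and let $f:\mathcal{M}\to\mathbb{R}^2$ be a simplicial mapping with vertex images $\mathbf{f}_\ell=f(v_\ell)=(f_\ell^1,f_\ell^2)^\top$, such that $f(\tau)$ is a nondegenerate triangle for every $\tau\in\mathcal{F}(\mathcal{M})$. Put $\mathbf{f}^s=(f_1^s,\dots,f_n^s)^\top$ for $s=1,2$, and define $\mathbf{h}^1,\mathbf{h}^2\in\mathbb{R}^n$ by $$\mathbf{h}^1_i=\frac12\sum_{\tau=[v_i,v_j,v_k]\in N_{\mathcal{F}}(v_i)}\frac{|f(\tau)|}{|\tau|}(f_j^2-f_k^2),\qquad \mathbf{h}^2_i=\frac12\sum_{\tau=[v_i,v_j,v_k]\in N_{\mathcal{F}}(v_i)}\frac{|f(\tau)|}{|\tau|}(f_k^1-f_j^1),$$ where $N_{\mathcal{F}}(v_i)$ is the set of triangular faces containing $v_i$, and in each summand the face is written as $[v_i,v_j,v_k]$ with its vertices listed so that $(\mathbf{f}_i,\mathbf{f}_j,\mathbf{f}_k)$ is counterclockwise, i.e. $|f(\tau)|=\frac12(f_i^1f_j^2-f_j^1f_i^2+f_k^1f_i^2-f_i^1f_k^2+f_j^1f_k^2-f_k^1f_j^2)$. Then $$\mathbf{h}^1=L_S(f)\,\mathbf{f}^1\quad\text{and}\quad \mathbf{h}^2=L_S(f)\,\mathbf{f}^2,$$ and, as a result, the gradient of the stretch energy $E_S$,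 regarded as a function of the $2n$ variables $f_\ell^s$, satisfies $$\nabla_{\mathbf{f}}E_S(f):=\begin{bmatrix}\nabla_{\mathbf{f}^1}E_S(f)\\ \nabla_{\mathbf{f}^2}E_S(f)\end{bmatrix}=2\begin{bmatrix}L_S(f)\,\mathbf{f}^1\\ L_S(f)\,\mathbf{f}^2\end{bmatrix}.$$
   Context: A simplicial surface $\mathcal{M}$ is a finite simplicial 2-complex in $\mathbb{R}^3$ that is the union of its (nondegenerate) triangular faces $\tau=[v_i,v_j,v_k]$, with edge set $\mathcal{E}(\mathcal{M})$ and face set $\mathcal{F}(\mathcal{M})$. $|\cdot|$ applied to a triangle denotes its area. A simplicial mapping $f:\mathcal{M}\to\mathbb{R}^2$ is a map that is affine on each face, hence determined by its vertex images $\mathbf{f}_\ell=f(v_\ell)$. The stretch energy is $$E_S(f)=\frac12\left((\mathbf{f}^1)^\top L_S(f)\,\mathbf{f}^1+(\mathbf{f}^2)^\top L_S(f)\,\mathbf{f}^2\right),$$ where $L_S(f)$ is the $n\times n$ matrix with $$[L_S(f)]_{i,j}=-\frac12\sum_{[v_i,v_j,v_k]\in\mathcal{F}(\mathcal{M})}\frac{\cot(\theta_{i,j}^k(f))\,|f([v_i,v_j,v_k])|}{|[v_i,v_j,v_k]|}\quad\text{if }i\neq j,\ [v_i,v_j]\in\mathcal{E}(\mathcal{M})$$ (sum over the faces containing the edge $[v_i,v_j]$), $[L_S(f)]_{i,i}=-\sum_{\ell\ne i}[L_S(f)]_{i,\ell}$, and all other entries $0$. Here $\theta_{i,j}^k(f)\in(0,\pi)$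 is the angle at $\mathbf{f}_k$, opposite the edge $[\mathbf{f}_i,\mathbf{f}_j]$, in the image triangle $[\mathbf{f}_i,\mathbf{f}_j,\mathbf{f}_k]$. *)

theory Defs
  imports "HOL-Analysis.Analysis"
begin

text \<open>A complex is a set of simplices as in \<^const>\<open>simplicial_complex\<close>. Since that notion is closed
  under \<^const>\<open>face_of\<close>, it also contains the empty \<open>(-1)\<close>-simplex.\<close>

definition vertices :: "(real^3) set set \<Rightarrow> (real^3) set" where
  "vertices M = {x. {x} \<in> M}"

definition edges :: "(real^3) set set \<Rightarrow> (real^3) set set" where
  "edges M = {e \<in> M. 1 simplex e}"

definition faces :: "(real^3) set set \<Rightarrow> (real^3) set set" where
  "faces M = {\<tau> \<in> M. 2 simplex \<tau>}"

definition simplicial_surface :: "(real^3) set set \<Rightarrow> bool" where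
  "simplicial_surface M \<longleftrightarrow>
     simplicial_complex M \<and> (\<forall>S\<in>M. aff_dim S \<le> 2) \<and> \<Union>M = \<Union>(faces M)"

text \<open>Maps on the surface are total functions on the ambient space; only their values on \<open>\<Union>M\<close>
  matter.\<close>

definition simplicial_map :: "(real^3) set set \<Rightarrow> (real^3 \<Rightarrow> real^2) \<Rightarrow> bool" where
  "simplicial_map M f \<longleftrightarrow>
     (\<forall>\<tau>\<in>faces M. \<exists>A b. linear A \<and> (\<forall>x\<in>\<tau>. f x = A x + b))"

text \<open>The vector \<open>(f\<^sub>1\<^sup>s, \<dots>, f\<^sub>n\<^sup>s)\<close> of the \<open>s\<close>-th coordinates of the vertex images.\<close>

definition vertex_coords :: "('n \<Rightarrow> real^3) \<Rightarrow> (real^3 \<Rightarrow> real^2) \<Rightarrow> 2 \<Rightarrow> real^'n" where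
  "vertex_coords v f s = (\<chi> l. f (v l) $ s)"

text \<open>A simplicial map with prescribed vertex images. It exists because the vertices of a face are
  affinely independent and two faces meet in a common face, and on \<open>\<Union>M\<close> it is unique.\<close>

definition simplicial_interp ::
  "(real^3) set set \<Rightarrow> ('n::finite \<Rightarrow> real^3) \<Rightarrow> real^'n \<Rightarrow> real^'n \<Rightarrow> (real^3 \<Rightarrow> real^2)" where
  "simplicial_interp M v x y =
     (SOME g. simplicial_map M g \<and> vertex_coords v g 1 = x \<and> vertex_coords v g 2 = y)"

text \<open>Area of the triangle with corners \<open>a\<close>, \<open>b\<close>, \<open>c\<close> in space. Image triangles are planar sets, and
  their area is their Lebesgue measure.\<close>

definition area3 :: "real^3 \<Rightarrow> real^3 \<Rightarrow> real^3 \<Rightarrow> real" where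
  "area3 a b c = norm (cross3 (b - a) (c - a)) / 2"

definition signed_area :: "real^2 \<Rightarrow> real^2 \<Rightarrow> real^2 \<Rightarrow> real" where
  "signed_area p q r =
     1/2 * (p$1 * q$2 - q$1 * p$2 + r$1 * p$2 - p$1 * r$2 + q$1 * r$2 - r$1 * q$2)"

text \<open>The angle at \<open>r\<close> in the triangle \<open>p\<close>, \<open>q\<close>, \<open>r\<close>.\<close>

definition angle_at :: "real^2 \<Rightarrow> real^2 \<Rightarrow> real^2 \<Rightarrow> real" where
  "angle_at r p q = arccos (((p - r) \<bullet> (q - r)) / (norm (p - r) * norm (q - r)))"

definition area_ratio ::
  "('n \<Rightarrow> real^3) \<Rightarrow> (real^3 \<Rightarrow> real^2) \<Rightarrow> 'n \<Rightarrow> 'n \<Rightarrow> 'n \<Rightarrow> real" where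
  "area_ratio v f i j k =
     measure lborel (f ` (convex hull {v i, v j, v k})) / area3 (v i) (v j) (v k)"

text \<open>An off-diagonal entry of \<open>L\<^sub>S(f)\<close>. As \<open>v\<close> enumerates the vertices injectively, the faces containing
  the edge of \<open>v i\<close> and \<open>v j\<close> correspond to the indices \<open>k\<close> of their third vertices.\<close>

definition stretch_entry ::
  "(real^3) set set \<Rightarrow> ('n::finite \<Rightarrow> real^3) \<Rightarrow> (real^3 \<Rightarrow> real^2) \<Rightarrow> 'n \<Rightarrow> 'n \<Rightarrow> real" where
  "stretch_entry M v f i j =
     (if convex hull {v i, v j} \<in> edges M
      then - 1/2 * (\<Sum>k | convex hull {v i, v j, v k} \<in> faces M.
              cot (angle_at (f (v k)) (f (v i)) (f (v j))) * area_ratio v f i j k)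
      else 0)"

definition stretch_laplacian ::
  "(real^3) set set \<Rightarrow> ('n::finite \<Rightarrow> real^3) \<Rightarrow> (real^3 \<Rightarrow> real^2) \<Rightarrow> real^'n^'n" where
  "stretch_laplacian M v f =
     (\<chi> i j. if i = j then - (\<Sum>l\<in>UNIV - {i}. stretch_entry M v f i l)
            else stretch_entry M v f i j)"

definition stretch_energy ::
  "(real^3) set set \<Rightarrow> ('n::finite \<Rightarrow> real^3) \<Rightarrow> (real^3 \<Rightarrow> real^2) \<Rightarrow> real" where
  "stretch_energy M v f =
     1/2 * (vertex_coords v f 1 \<bullet> (stretch_laplacian M v f *v vertex_coords v f 1)
          + vertex_coords v f 2 \<bullet> (stretch_laplacian M v f *v vertex_coords v f 2))"

text \<open>The faces containing \<open>v i\<close>, each written with its vertices in the order \<open>i\<close>, \<open>j\<close>, \<open>k\<close> for which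
  the image is counterclockwise. If the image of a face is nondegenerate, exactly one of the
  two orders \<open>(j, k)\<close>, \<open>(k, j)\<close> qualifies, so the face is listed exactly once.\<close>

definition ccw_faces_at ::
  "(real^3) set set \<Rightarrow> ('n \<Rightarrow> real^3) \<Rightarrow> (real^3 \<Rightarrow> real^2) \<Rightarrow> 'n \<Rightarrow> ('n \<times> 'n) set" where
  "ccw_faces_at M v f i =
     {(j, k). convex hull {v i, v j, v k} \<in> faces M \<and>
        measure lborel (f ` (convex hull {v i, v j, v k})) = signed_area (f (v i)) (f (v j)) (f (v k))}"

end

(*
  Write S for the signed area of an image triangle. Since cot (angle at f_k) * |S| is half the inner
  product of the edges at f_k, the cotangents disappear from the entries of L_S(f), and adding the
  two terms of (L_S(f) f^s)_i that belong to one face tau gives S / (2 |tau|) times the rotated edge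
  opposite to i, which is the formula for h^s. Summing f_i . (L_S(f) f)_i cyclically over the corners
  of each face turns the energy into the sum of S^2 / |tau| over all faces, as long as no image face
  is degenerate. This condition is open, so E_S is a polynomial in the vertex images near f, and the
  derivative of S in f_i is half the rotated opposite edge, hence the gradient is 2 h^s.
*)
theory Submission
  imports Defs
begin

section \<open>Signed areas and cotangents of planar triangles\<close>

lemma signed_area_swap: "signed_area p r q = - signed_area p q r"
  by (simp add: signed_area_def algebra_simps)

lemma signed_area_rotate: "signed_area q r p = signed_area p q r"
  by (simp add: signed_area_def algebra_simps)

lemma measure_triangle:
  "measure lborel (convex hull {p, q, r}) = \<bar>signed_area p q r\<bar>"
  unfolding content_triangle signed_area_def by (simp add: abs_if algebra_simps)

text \<open>A 2-simplex in the plane is full-dimensional, so it has interior points and positive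
  measure, which is the absolute value of its signed area.\<close>

lemma signed_area_nonzero:
  assumes "2 simplex (convex hull {p, q, r})"
  shows "signed_area p q r \<noteq> 0"
proof -
  have full: "aff_dim (convex hull {p, q, r}) = DIM(real^2)"
    using aff_dim_simplex[OF assms] by simp
  then have "rel_interior (convex hull {p, q, r}) \<noteq> {}"
    by (simp add: rel_interior_eq_empty)
  with full have "interior (convex hull {p, q, r}) \<noteq> {}"
    by (metis interior_rel_interior_gen)
  then have "\<not> negligible (convex hull {p, q, r})"
    by (simp add: negligible_convex_interior)
  then have "measure lebesgue (convex hull {p, q, r}) \<noteq> 0"
    by (simp add: negligible_iff_measure finite_imp_compact_convex_hull lmeasurable_compact)
  moreover have "measure lebesgue (convex hull {p, q, r}) = measure lborel (convex hull {p, q, r})"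
    by (simp add: measure_completion borel_compact finite_imp_compact_convex_hull)
  ultimately show ?thesis by (simp add: measure_triangle)
qed

lemma area3_swap: "area3 a c b = area3 a b c"
  unfolding area3_def by (metis cross_skew norm_minus_cancel)

lemma area3_rotate: "area3 b c a = area3 a b c"
proof -
  have "cross3 (c - b) (a - b) = cross3 (b - a) (c - a)"
    by (simp add: cross3_simps)
  then show ?thesis by (simp add: area3_def)
qed

text \<open>The cosine of the angle is the inner product divided by the product of the lengths, and
  the sine is twice the area divided by the same product, which therefore cancels. Multiplying by
  the area leaves a polynomial in the corners.\<close>

lemma cot_angle_at:
  assumes "signed_area p q r \<noteq> 0"
  shows "cot (angle_at r p q) * \<bar>signed_area p q r\<bar> = (p - r) \<bullet> (q - r) / 2"
proof -
  define D N S where "D = (p - r) \<bullet> (q - r)" and "N = norm (p - r) * norm (q - r)"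
    and "S = \<bar>signed_area p q r\<bar>"
  \<comment> \<open>Lagrange's identity; \<open>2 * S\<close> is the absolute value of the cross product.\<close>
  have lagrange: "N\<^sup>2 - D\<^sup>2 = (2 * S)\<^sup>2"
    unfolding D_def N_def S_def power_mult_distrib power2_norm_eq_inner power2_abs
    by (simp add: inner_vec_def sum_2 signed_area_def power2_eq_square) algebra
  have "S > 0" using assms by (simp add: S_def)
  then have "D\<^sup>2 < N\<^sup>2" using lagrange by (smt (verit) zero_less_power2)
  moreover have "N \<ge> 0" by (simp add: N_def)
  ultimately have DN: "\<bar>D\<bar> < N"
    using power2_less_imp_less[of "\<bar>D\<bar>" N] by simp
  then have "N > 0" by simp
  have "\<bar>D / N\<bar> < 1" using DN \<open>N > 0\<close> by simp
  then have bounds: "-1 \<le> D / N" "D / N \<le> 1" by linarith+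
  have "1 - (D / N)\<^sup>2 = (2 * S / N)\<^sup>2"
    unfolding power_divide lagrange [symmetric] using \<open>N > 0\<close> by (simp add: diff_divide_distrib)
  then have "sin (arccos (D / N)) = 2 * S / N"
    using bounds \<open>S > 0\<close> \<open>N > 0\<close> by (simp add: sin_arccos)
  then have "cot (arccos (D / N)) = D / (2 * S)"
    using bounds \<open>N > 0\<close> by (simp add: cot_def)
  then show ?thesis
    using \<open>S > 0\<close> by (simp add: angle_at_def D_def [symmetric] N_def [symmetric] S_def [symmetric])
qed

section \<open>Affine maps on convex hulls and their extension\<close>

lemma affine_image_convex_hull:
  assumes "linear A" and "\<And>x. x \<in> convex hull S \<Longrightarrow> f x = A x + b"
  shows "f ` (convex hull S) = convex hull (f ` S)"
proof -
  have "f ` (convex hull S) = (\<lambda>x. b + x) ` A ` (convex hull S)"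
    unfolding image_image using assms(2) by (intro image_cong) (auto simp: add.commute)
  also have "\<dots> = convex hull ((\<lambda>x. b + x) ` A ` S)"
    by (simp add: convex_hull_linear_image assms(1) convex_hull_translation)
  also have "(\<lambda>x. b + x) ` A ` S = f ` S"
    unfolding image_image using assms(2) hull_inc[of _ S convex]
    by (intro image_cong) (auto simp: add.commute)
  finally show ?thesis .
qed

text \<open>The set on which two affine maps agree is convex.\<close>

lemma affine_maps_agree_on_convex_hull:
  assumes "linear A" "linear B"
    and agree: "\<And>x. x \<in> S \<Longrightarrow> A x + a = B x + b"
    and "x \<in> convex hull S"
  shows "A x + a = B x + b"
proof -
  have "convex {x. A x + a = B x + b}"
  proof (rule convexI)
    fix x y :: 'a and s t :: real
    assume *: "x \<in> {x. A x + a = B x + b}" "y \<in> {x. A x + a = B x + b}" and "s + t = 1"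
    have lin: "A (s *\<^sub>R x + t *\<^sub>R y) = s *\<^sub>R A x + t *\<^sub>R A y"
      "B (s *\<^sub>R x + t *\<^sub>R y) = s *\<^sub>R B x + t *\<^sub>R B y"
      using assms by (simp_all add: linear_add linear_scale)
    have "s *\<^sub>R A x + t *\<^sub>R A y + (s + t) *\<^sub>R a = s *\<^sub>R (A x + a) + t *\<^sub>R (A y + a)"
      by (simp add: algebra_simps)
    also have "\<dots> = s *\<^sub>R (B x + b) + t *\<^sub>R (B y + b)" using * by simp
    also have "\<dots> = s *\<^sub>R B x + t *\<^sub>R B y + (s + t) *\<^sub>R b" by (simp add: algebra_simps)
    finally show "s *\<^sub>R x + t *\<^sub>R y \<in> {x. A x + a = B x + b}"
      using \<open>s + t = 1\<close> lin by simp
  qed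
  then show ?thesis using hull_minimal[of S "{x. A x + a = B x + b}" convex] agree assms(4) by auto
qed

text \<open>Moving one point \<open>a\<close> of \<open>C\<close> to the origin turns affine into
  linear independence, so the differences \<open>c x - c a\<close> extend linearly; the translation
  restores the value at \<open>a\<close>.\<close>

lemma affine_independent_extend:
  fixes C :: "'a::euclidean_space set" and c :: "'a \<Rightarrow> 'b::real_vector"
  assumes "\<not> affine_dependent C"
  obtains A b where "linear A" "\<And>x. x \<in> C \<Longrightarrow> A x + b = c x"
proof (cases "C = {}")
  case True
  with that[of "\<lambda>x. 0" 0] show thesis by (simp add: linear_zero)
next
  case False
  then obtain a where "a \<in> C" by blast
  with assms have "independent ((\<lambda>x. - a + x) ` (C - {a}))"
    by (simp add: affine_dependent_iff_dependent2)
  then obtain A where A: "linear A"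
    and ext: "\<And>y. y \<in> (\<lambda>x. - a + x) ` (C - {a}) \<Longrightarrow> A y = c (a + y) - c a"
    using linear_independent_extend[of _ "\<lambda>y. c (a + y) - c a"] by blast
  have "A x + (c a - A a) = c x" if "x \<in> C" for x
  proof (cases "x = a")
    case False
    then have "A (- a + x) = c x - c a" using ext that by auto
    moreover have "A (- a + x) = A x - A a" using A using linear_add[OF A, of a "- a + x"] by (simp add: algebra_simps)
    ultimately have "A x - A a = c x - c a" by simp
    then show ?thesis by (simp add: algebra_simps)
  qed simp
  with A that show thesis by blast
qed

section \<open>Simplicial complexes and interpolation of vertex values\<close>

lemma simplicial_complexD:
  assumes "simplicial_complex M" "S \<in> M"
  shows "\<exists>n. n simplex S"
    and "F face_of S \<Longrightarrow> F \<in> M"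
    and "T \<in> M \<Longrightarrow> (S \<inter> T) face_of S"
proof -
  note complex = assms(1)[unfolded simplicial_complex_def, THEN conjunct2]
  show "\<exists>n. n simplex S"
    using complex [THEN conjunct1] assms(2) by (rule bspec)
  show "F \<in> M" if "F face_of S"
    using complex [THEN conjunct2, THEN conjunct1, rule_format, of S F] assms(2) that by simp
  show "(S \<inter> T) face_of S" if "T \<in> M"
    using complex [THEN conjunct2, THEN conjunct2, rule_format, of S T] assms(2) that by simp
qed

text \<open>Corners spanning dimension 2 are affinely independent, so two of them span a face of the
  triangle, which the complex contains. Hence the edge test in \<open>stretch_entry\<close> never
  discards the term of a face.\<close>

lemma face_imp_edge:
  assumes "simplicial_complex M" and face: "convex hull {a, b, c} \<in> faces M"
  shows "convex hull {a, b} \<in> edges M"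
proof -
  have M: "convex hull {a, b, c} \<in> M" and "2 simplex (convex hull {a, b, c})"
    using face by (auto simp: faces_def)
  then have dim: "aff_dim {a, b, c} = 2"
    using aff_dim_simplex[of 2 "convex hull {a, b, c}"] by (simp add: aff_dim_convex_hull)
  \<comment> \<open>The three points might coincide a priori; dimension 2 forces them to be
    distinct.\<close>
  have "card {a, b, c} \<le> 3" by (simp add: card_insert_if)
  moreover have "2 \<le> int (card {a, b, c}) - 1"
    using aff_dim_le_card[of "{a, b, c}"] dim by simp
  ultimately have card: "card {a, b, c} = 3" by linarith
  then have indep: "\<not> affine_dependent {a, b, c}"
    unfolding affine_independent_iff_card dim card by simp
  then have "convex hull {a, b} face_of convex hull {a, b, c}"
    unfolding face_of_convex_hull_affine_independent[OF indep]
    by (intro exI[of _ "{a, b}"]) auto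
  then have "convex hull {a, b} \<in> M"
    by (rule simplicial_complexD(2)[OF assms(1) M])
  moreover have "a \<noteq> b"
  proof
    assume "a = b"
    then have "card {a, b, c} \<le> 2" by (simp add: card_insert_if)
    with card show False by simp
  qed
  then have "1 simplex (convex hull {a, b})"
    unfolding segment_convex_hull [symmetric] by (rule one_simplex_segment)
  ultimately show ?thesis by (simp add: edges_def)
qed

text \<open>Each simplex carries an affine map with the prescribed values at its corners. Two
  simplices meet in a common face whose corners are vertices of the complex, so their maps agree
  there and glue together.\<close>

lemma simplicial_map_exists:
  fixes c :: "real^3 \<Rightarrow> real^2"
  assumes cx: "simplicial_complex M"
  obtains g where "simplicial_map M g" "\<And>p. p \<in> vertices M \<Longrightarrow> g p = c p"
proof -
  note sub = simplicial_complexD(2)[OF cx] and meet = simplicial_complexD(3)[OF cx]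
  have hull: "\<exists>C. \<not> affine_dependent C \<and> S = convex hull C" if "S \<in> M" for S
    using simplicial_complexD(1)[OF cx that] unfolding simplex_def by blast
  have "\<exists>A b. linear A \<and> (\<forall>p\<in>vertices M \<inter> \<tau>. A p + b = c p)" if "\<tau> \<in> M" for \<tau>
  proof -
    obtain C where C: "\<not> affine_dependent C" "\<tau> = convex hull C"
      using hull[OF \<open>\<tau> \<in> M\<close>] by blast
    \<comment> \<open>A vertex of the complex that lies in \<open>\<tau>\<close> meets
      \<open>\<tau>\<close> in a face, so it is an extreme point and hence a corner.\<close>
    have "p \<in> C" if "p \<in> vertices M \<inter> \<tau>" for p
    proof -
      have "{p} face_of \<tau>"
        using meet[OF \<open>\<tau> \<in> M\<close>, of "{p}"] that by (simp add: vertices_def Int_absorb1)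
      then show ?thesis
        using C(2) by (simp add: face_of_singleton extreme_point_of_convex_hull)
    qed
    moreover obtain A b where "linear A" "\<And>x. x \<in> C \<Longrightarrow> A x + b = c x"
      using affine_independent_extend[OF C(1), of c] by blast
    ultimately show ?thesis by blast
  qed
  then have "\<forall>\<tau>\<in>M. \<exists>A b. linear A \<and> (\<forall>p\<in>vertices M \<inter> \<tau>. A p + b = c p)"
    by (rule ballI)
  from bchoice[OF this] obtain A
    where "\<forall>\<tau>\<in>M. \<exists>b. linear (A \<tau>) \<and> (\<forall>p\<in>vertices M \<inter> \<tau>. A \<tau> p + b = c p)" ..
  from bchoice[OF this] obtain b
    where "\<forall>\<tau>\<in>M. linear (A \<tau>) \<and> (\<forall>p\<in>vertices M \<inter> \<tau>. A \<tau> p + b \<tau> = c p)" ..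
  then have lin: "\<And>\<tau>. \<tau> \<in> M \<Longrightarrow> linear (A \<tau>)"
    and Ab: "\<And>\<tau> p. \<tau> \<in> M \<Longrightarrow> p \<in> vertices M \<Longrightarrow> p \<in> \<tau> \<Longrightarrow> A \<tau> p + b \<tau> = c p"
    by blast+
  have agree: "A \<sigma> x + b \<sigma> = A \<tau> x + b \<tau>"
    if "\<sigma> \<in> M" "\<tau> \<in> M" "x \<in> \<sigma>" "x \<in> \<tau>" for \<sigma> \<tau> x
  proof -
    have in_M: "\<sigma> \<inter> \<tau> \<in> M" using sub[OF that(1) meet[OF that(1,2)]] .
    then obtain C where C: "\<not> affine_dependent C" "\<sigma> \<inter> \<tau> = convex hull C"
      using hull[OF in_M] by blast
    have "p \<in> vertices M" if "p \<in> C" for p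
    proof -
      have "{p} face_of \<sigma> \<inter> \<tau>"
        using C that by (simp add: face_of_singleton extreme_point_of_convex_hull_affine_independent)
      then show ?thesis using sub[OF in_M] by (simp add: vertices_def)
    qed
    moreover have "C \<subseteq> \<sigma>" "C \<subseteq> \<tau>" using C(2) hull_subset[of C convex] by auto
    ultimately have "A \<sigma> p + b \<sigma> = A \<tau> p + b \<tau>" if "p \<in> C" for p
      using Ab[OF \<open>\<sigma> \<in> M\<close>, of p] Ab[OF \<open>\<tau> \<in> M\<close>, of p] that by (simp add: subset_iff)
    moreover have "x \<in> convex hull C" using that C(2) by blast
    ultimately show ?thesis
      using affine_maps_agree_on_convex_hull[OF lin[OF that(1)] lin[OF that(2)]] by blast
  qed
  \<comment> \<open>By \<open>agree\<close> the chosen simplex does not affect the value; outside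
    \<open>\<Union>M\<close> the value is arbitrary.\<close>
  define g where "g x = (let \<tau> = (SOME \<tau>. \<tau> \<in> M \<and> x \<in> \<tau>) in A \<tau> x + b \<tau>)" for x
  have g: "g x = A \<tau> x + b \<tau>" if "\<tau> \<in> M" "x \<in> \<tau>" for x \<tau>
  proof -
    define \<sigma> where "\<sigma> = (SOME \<tau>. \<tau> \<in> M \<and> x \<in> \<tau>)"
    have "\<sigma> \<in> M \<and> x \<in> \<sigma>"
      unfolding \<sigma>_def by (rule someI[of _ \<tau>]) (use that in simp)
    then have "A \<sigma> x + b \<sigma> = A \<tau> x + b \<tau>"
      using agree[of \<sigma> \<tau> x] that by blast
    then show ?thesis by (simp add: g_def \<sigma>_def Let_def)
  qed
  have "simplicial_map M g"
    unfolding simplicial_map_def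
  proof
    fix \<tau> assume "\<tau> \<in> faces M"
    then have "\<tau> \<in> M" by (simp add: faces_def)
    then show "\<exists>A b. linear A \<and> (\<forall>x\<in>\<tau>. g x = A x + b)"
      using lin g by blast
  qed
  moreover have "g p = c p" if "p \<in> vertices M" for p
    using that g[of "{p}" p] Ab[of "{p}" p] by (simp add: vertices_def)
  ultimately show thesis by (rule that)
qed

text \<open>Existence makes the choice operator deliver its specification; \<open>inv v\<close>
  carries the coordinate vectors back to the vertices.\<close>

lemma simplicial_interp:
  fixes v :: "'n::finite \<Rightarrow> real^3"
  assumes "simplicial_complex M" and v: "bij_betw v UNIV (vertices M)"
  shows "simplicial_map M (simplicial_interp M v x y)"
    and "vertex_coords v (simplicial_interp M v x y) 1 = x"
    and "vertex_coords v (simplicial_interp M v x y) 2 = y"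
proof -
  have inv: "inv v (v l) = l" for l using v by (simp add: bij_betw_def)
  have mem: "v l \<in> vertices M" for l using v by (auto simp: bij_betw_def)
  obtain g where g: "simplicial_map M g"
    "\<And>p. p \<in> vertices M \<Longrightarrow> g p = vector [x $ inv v p, y $ inv v p]"
    using simplicial_map_exists[OF assms(1), of "\<lambda>p. vector [x $ inv v p, y $ inv v p]"] by blast
  have "vertex_coords v g 1 = x" "vertex_coords v g 2 = y"
    by (simp_all add: vertex_coords_def vec_eq_iff g(2) mem inv)
  with g(1) have "\<exists>g. simplicial_map M g \<and> vertex_coords v g 1 = x \<and> vertex_coords v g 2 = y"
    by blast
  then have "simplicial_map M (simplicial_interp M v x y) \<and>
    vertex_coords v (simplicial_interp M v x y) 1 = x \<and>
    vertex_coords v (simplicial_interp M v x y) 2 = y"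
    unfolding simplicial_interp_def by (rule someI_ex)
  then show "simplicial_map M (simplicial_interp M v x y)"
    "vertex_coords v (simplicial_interp M v x y) 1 = x"
    "vertex_coords v (simplicial_interp M v x y) 2 = y" by blast+
qed

section \<open>The stretch Laplacian as a sum over index triples\<close>

text \<open>Sums over faces are written as sums over all index triples: a face occurs once for each of the
  six orderings of its vertices, and triples that span no face get weight \<open>0\<close>.\<close>

definition face_weight :: "(real^3) set set \<Rightarrow> ('n \<Rightarrow> real^3) \<Rightarrow> 'n \<Rightarrow> 'n \<Rightarrow> 'n \<Rightarrow> real" where
  "face_weight M v i j k =
     (if convex hull {v i, v j, v k} \<in> faces M then 1 / area3 (v i) (v j) (v k) else 0)"

lemma face_weight_swap: "face_weight M v i k j = face_weight M v i j k"
  by (simp add: face_weight_def insert_commute area3_swap[of _ "v k"])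

lemma face_weight_rotate: "face_weight M v j k i = face_weight M v i j k"
  by (simp add: face_weight_def insert_commute area3_rotate)

definition image_area :: "('n \<Rightarrow> real^3) \<Rightarrow> (real^3 \<Rightarrow> real^2) \<Rightarrow> 'n \<Rightarrow> 'n \<Rightarrow> 'n \<Rightarrow> real" where
  "image_area v f i j k = signed_area (f (v i)) (f (v j)) (f (v k))"

lemma image_area_swap: "image_area v f i k j = - image_area v f i j k"
  unfolding image_area_def by (rule signed_area_swap)

lemma image_area_rotate: "image_area v f j k i = image_area v f i j k"
  unfolding image_area_def by (rule signed_area_rotate)

text \<open>Phrased through signed areas rather than simplices, so that it is visibly an open
  condition on the vertex images.\<close>

definition nondegenerate_on_faces ::
  "(real^3) set set \<Rightarrow> ('n \<Rightarrow> real^3) \<Rightarrow> (real^3 \<Rightarrow> real^2) \<Rightarrow> bool" where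
  "nondegenerate_on_faces M v f \<longleftrightarrow>
     (\<forall>i j k. convex hull {v i, v j, v k} \<in> faces M \<longrightarrow> image_area v f i j k \<noteq> 0)"

lemma image_face:
  assumes "simplicial_map M f" "convex hull {a, b, c} \<in> faces M"
  shows "f ` (convex hull {a, b, c}) = convex hull {f a, f b, f c}"
proof -
  obtain A d where "linear A" "\<And>x. x \<in> convex hull {a, b, c} \<Longrightarrow> f x = A x + d"
    using assms unfolding simplicial_map_def by blast
  then have "f ` (convex hull {a, b, c}) = convex hull (f ` {a, b, c})"
    by (rule affine_image_convex_hull)
  then show ?thesis by simp
qed

lemma measure_image_face:
  assumes "simplicial_map M f" "convex hull {v i, v j, v k} \<in> faces M"
  shows "measure lborel (f ` (convex hull {v i, v j, v k})) = \<bar>image_area v f i j k\<bar>"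
  using image_face[OF assms] by (simp add: measure_triangle image_area_def)

lemma area_ratio_eq:
  assumes "simplicial_map M f" "convex hull {v i, v j, v k} \<in> faces M"
  shows "area_ratio v f i j k = face_weight M v i j k * \<bar>image_area v f i j k\<bar>"
  using assms by (simp add: area_ratio_def face_weight_def measure_image_face)

text \<open>\<open>cot_angle_at\<close> absorbs the image area, and its factor 1/2 joins the one in
  the definition. Weights vanish off the faces, so \<open>k\<close> may range over all
  indices.\<close>

lemma stretch_entry_eq:
  assumes "simplicial_complex M" and map: "simplicial_map M f"
    and nondeg: "nondegenerate_on_faces M v f"
  shows "stretch_entry M v f i j =
    - 1/4 * (\<Sum>k\<in>UNIV. face_weight M v i j k * ((f (v i) - f (v k)) \<bullet> (f (v j) - f (v k))))"
proof -
  have "(\<Sum>k | convex hull {v i, v j, v k} \<in> faces M.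
          cot (angle_at (f (v k)) (f (v i)) (f (v j))) * area_ratio v f i j k) =
        (\<Sum>k | convex hull {v i, v j, v k} \<in> faces M.
          face_weight M v i j k * ((f (v i) - f (v k)) \<bullet> (f (v j) - f (v k)) / 2))"
  proof (rule sum.cong, simp)
    fix k assume "k \<in> {k. convex hull {v i, v j, v k} \<in> faces M}"
    then have k: "convex hull {v i, v j, v k} \<in> faces M" by simp
    then have "signed_area (f (v i)) (f (v j)) (f (v k)) \<noteq> 0"
      using nondeg by (simp add: nondegenerate_on_faces_def image_area_def)
    from cot_angle_at[OF this]
    show "cot (angle_at (f (v k)) (f (v i)) (f (v j))) * area_ratio v f i j k =
      face_weight M v i j k * ((f (v i) - f (v k)) \<bullet> (f (v j) - f (v k)) / 2)"
      unfolding area_ratio_eq[where f = f and v = v, OF map k] image_area_def by (metis mult.left_commute)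
  qed
  also have "\<dots> = (\<Sum>k\<in>UNIV. face_weight M v i j k * ((f (v i) - f (v k)) \<bullet> (f (v j) - f (v k)) / 2))"
    by (rule sum.mono_neutral_left) (auto simp: face_weight_def)
  finally have sum: "(\<Sum>k | convex hull {v i, v j, v k} \<in> faces M.
          cot (angle_at (f (v k)) (f (v i)) (f (v j))) * area_ratio v f i j k) =
        1/2 * (\<Sum>k\<in>UNIV. face_weight M v i j k * ((f (v i) - f (v k)) \<bullet> (f (v j) - f (v k))))"
    by (simp add: sum_divide_distrib)
  show ?thesis
  proof (cases "convex hull {v i, v j} \<in> edges M")
    case True
    then show ?thesis by (simp add: stretch_entry_def sum)
  next
    case False
    then have "convex hull {v i, v j, v k} \<notin> faces M" for k
      using face_imp_edge[OF assms(1)] by blast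
    then show ?thesis using False by (simp add: stretch_entry_def face_weight_def)
  qed
qed

text \<open>The rows of the Laplacian sum to zero, so the diagonal term turns the others into
  differences.\<close>

lemma stretch_laplacian_mult:
  "(stretch_laplacian M v f *v x) $ i = (\<Sum>j\<in>UNIV. stretch_entry M v f i j * (x $ j - x $ i))"
proof -
  let ?L = "stretch_laplacian M v f" and ?e = "stretch_entry M v f i"
  have "(?L *v x) $ i = (\<Sum>j\<in>UNIV. ?L $ i $ j * x $ j)"
    by (simp add: matrix_vector_mult_def)
  also have "\<dots> = ?L $ i $ i * x $ i + (\<Sum>j\<in>UNIV - {i}. ?L $ i $ j * x $ j)"
    by (rule sum.remove) auto
  also have "(\<Sum>j\<in>UNIV - {i}. ?L $ i $ j * x $ j) = (\<Sum>j\<in>UNIV - {i}. ?e j * x $ j)"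
    by (rule sum.cong) (auto simp: stretch_laplacian_def)
  also have "?L $ i $ i * x $ i = (\<Sum>j\<in>UNIV - {i}. - ?e j * x $ i)"
    by (simp add: stretch_laplacian_def sum_negf sum_distrib_right)
  also have "\<dots> + (\<Sum>j\<in>UNIV - {i}. ?e j * x $ j) = (\<Sum>j\<in>UNIV - {i}. ?e j * (x $ j - x $ i))"
    unfolding sum.distrib [symmetric] by (rule sum.cong) (auto simp: algebra_simps)
  also have "\<dots> = (\<Sum>j\<in>UNIV. ?e j * (x $ j - x $ i))"
    by (rule sum.mono_neutral_left) auto
  finally show ?thesis .
qed

text \<open>Pairs the two orders in which a face at a fixed vertex is listed.\<close>

lemma sum_symmetrize:
  fixes g :: "'n::finite \<Rightarrow> 'n \<Rightarrow> real"
  shows "(\<Sum>j\<in>UNIV. \<Sum>k\<in>UNIV. g j k) = 1/2 * (\<Sum>j\<in>UNIV. \<Sum>k\<in>UNIV. g j k + g k j)"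
  unfolding sum.distrib using sum.swap[of g UNIV UNIV] by argo

text \<open>Rotating the indices permutes the triples. This serves both the energy and its
  derivative.\<close>

lemma sum_cyclic:
  fixes g :: "'n::finite \<Rightarrow> 'n \<Rightarrow> 'n \<Rightarrow> real"
  shows "(\<Sum>i\<in>UNIV. \<Sum>j\<in>UNIV. \<Sum>k\<in>UNIV. g i j k) =
    1/3 * (\<Sum>i\<in>UNIV. \<Sum>j\<in>UNIV. \<Sum>k\<in>UNIV. g i j k + g j k i + g k i j)"
proof -
  have rot: "(\<Sum>i\<in>UNIV. \<Sum>j\<in>UNIV. \<Sum>k\<in>UNIV. g j k i) = (\<Sum>i\<in>UNIV. \<Sum>j\<in>UNIV. \<Sum>k\<in>UNIV. g i j k)"
    for g :: "'n \<Rightarrow> 'n \<Rightarrow> 'n \<Rightarrow> real"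
  proof -
    have "(\<Sum>i\<in>UNIV. \<Sum>j\<in>UNIV. \<Sum>k\<in>UNIV. g j k i) = (\<Sum>j\<in>UNIV. \<Sum>i\<in>UNIV. \<Sum>k\<in>UNIV. g j k i)"
      by (rule sum.swap)
    also have "\<dots> = (\<Sum>j\<in>UNIV. \<Sum>k\<in>UNIV. \<Sum>i\<in>UNIV. g j k i)"
      by (intro sum.cong refl sum.swap)
    finally show ?thesis .
  qed
  \<comment> \<open>The second instance rotates an already rotated summand and so handles
    \<open>g k i j\<close>.\<close>
  show ?thesis
    using arg_cong2[OF rot[of g] rot[of "\<lambda>i j k. g j k i"], of "(+)"] rot[of g]
    unfolding sum.distrib by argo
qed

text \<open>A face at \<open>i\<close> enters through its entries for \<open>j\<close> and for
  \<open>k\<close>. Together they give a multiple of the signed area times the opposite edge rotated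
  by a right angle.\<close>

lemma stretch_laplacian_coords:
  fixes v :: "'n::finite \<Rightarrow> real^3"
  assumes "simplicial_complex M" "simplicial_map M f" "nondegenerate_on_faces M v f"
  shows "(stretch_laplacian M v f *v vertex_coords v f 1) $ i =
      1/4 * (\<Sum>j\<in>UNIV. \<Sum>k\<in>UNIV. face_weight M v i j k * image_area v f i j k * (f (v j) $ 2 - f (v k) $ 2))"
    and "(stretch_laplacian M v f *v vertex_coords v f 2) $ i =
      1/4 * (\<Sum>j\<in>UNIV. \<Sum>k\<in>UNIV. face_weight M v i j k * image_area v f i j k * (f (v k) $ 1 - f (v j) $ 1))"
proof -
  define w where "w j k = face_weight M v i j k" for j k
  define q where "q s j k = ((f (v i) - f (v k)) \<bullet> (f (v j) - f (v k))) * (f (v j) $ s - f (v i) $ s)" for s j k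
  have sym: "w k j = w j k" for j k by (simp add: w_def face_weight_swap)
  have L: "(stretch_laplacian M v f *v vertex_coords v f s) $ i =
      - 1/8 * (\<Sum>j\<in>UNIV. \<Sum>k\<in>UNIV. w j k * (q s j k + q s k j))" for s
  proof -
    have "(stretch_laplacian M v f *v vertex_coords v f s) $ i =
        - 1/4 * (\<Sum>j\<in>UNIV. \<Sum>k\<in>UNIV. w j k * q s j k)"
      unfolding stretch_laplacian_mult stretch_entry_eq[OF assms]
      by (simp add: sum_distrib_left sum_distrib_right sum_negf w_def q_def vertex_coords_def mult.assoc)
    also have "(\<Sum>j\<in>UNIV. \<Sum>k\<in>UNIV. w j k * q s j k) =
        1/2 * (\<Sum>j\<in>UNIV. \<Sum>k\<in>UNIV. w j k * (q s j k + q s k j))"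
      by (subst sum_symmetrize) (simp add: sym distrib_left)
    finally show ?thesis by simp
  qed
  \<comment> \<open>This is the expansion of a vector triple product: the edge from \<open>j\<close>
    to \<open>k\<close> crossed with the product of the two edges at \<open>i\<close>, whose length
    is twice the area.\<close>
  have "q 1 j k + q 1 k j = - 2 * image_area v f i j k * (f (v j) $ 2 - f (v k) $ 2)"
    and "q 2 j k + q 2 k j = - 2 * image_area v f i j k * (f (v k) $ 1 - f (v j) $ 1)" for j k
    unfolding q_def image_area_def signed_area_def by (simp_all add: inner_vec_def sum_2) algebra+
  then show "(stretch_laplacian M v f *v vertex_coords v f 1) $ i =
      1/4 * (\<Sum>j\<in>UNIV. \<Sum>k\<in>UNIV. face_weight M v i j k * image_area v f i j k * (f (v j) $ 2 - f (v k) $ 2))"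
    and "(stretch_laplacian M v f *v vertex_coords v f 2) $ i =
      1/4 * (\<Sum>j\<in>UNIV. \<Sum>k\<in>UNIV. face_weight M v i j k * image_area v f i j k * (f (v k) $ 1 - f (v j) $ 1))"
    unfolding L by (simp_all add: w_def sum_distrib_left mult.assoc)
qed

text \<open>Swapping \<open>j\<close> and \<open>k\<close> changes the sign of both the area and
  \<open>d\<close>, so the full sum counts each face twice with equal terms, whereas the
  counterclockwise list has it once.\<close>

lemma sum_ccw_faces_at:
  fixes v :: "'n::finite \<Rightarrow> real^3"
  assumes map: "simplicial_map M f" and nondeg: "nondegenerate_on_faces M v f"
    and anti: "\<And>j k. d k j = - d j k"
  shows "(\<Sum>(j, k)\<in>ccw_faces_at M v f i. area_ratio v f i j k * d j k) =
    1/2 * (\<Sum>j\<in>UNIV. \<Sum>k\<in>UNIV. face_weight M v i j k * image_area v f i j k * d j k)"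
proof -
  define g where "g j k = (if (j, k) \<in> ccw_faces_at M v f i then area_ratio v f i j k * d j k else 0)"
    for j k
  \<comment> \<open>The measure is the absolute value of the signed area, so equality with the
    signed area means that the latter is nonnegative.\<close>
  have ccw: "(j, k) \<in> ccw_faces_at M v f i \<longleftrightarrow>
      convex hull {v i, v j, v k} \<in> faces M \<and> image_area v f i j k \<ge> 0" for j k
    unfolding ccw_faces_at_def using measure_image_face[OF map, of v i j k]
    by (auto simp: image_area_def [symmetric])
  have *: "g j k + g k j = face_weight M v i j k * image_area v f i j k * d j k" for j k
  proof (cases "convex hull {v i, v j, v k} \<in> faces M")
    case True
    then have True': "convex hull {v i, v k, v j} \<in> faces M" by (simp add: insert_commute)
    have "image_area v f i j k \<noteq> 0"
      using True nondeg by (simp add: nondegenerate_on_faces_def)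
    then show ?thesis
      unfolding g_def ccw using True True'
      by (auto simp: area_ratio_eq[OF map] image_area_swap[of v f i k j] face_weight_swap[of M v i k j]
          anti[of k j])
  next
    case False
    then have "convex hull {v i, v k, v j} \<notin> faces M" by (simp add: insert_commute)
    with False show ?thesis by (simp add: g_def ccw face_weight_def)
  qed
  have "(\<Sum>(j, k)\<in>ccw_faces_at M v f i. area_ratio v f i j k * d j k) =
      (\<Sum>(j, k)\<in>UNIV. g j k)"
    by (rule sum.mono_neutral_cong_left) (auto simp: g_def)
  also have "\<dots> = (\<Sum>j\<in>UNIV. \<Sum>k\<in>UNIV. g j k)"
    by (simp add: sum.cartesian_product)
  also have "\<dots> = 1/2 * (\<Sum>j\<in>UNIV. \<Sum>k\<in>UNIV. g j k + g k j)"
    by (rule sum_symmetrize)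
  finally show ?thesis by (simp add: *)
qed

text \<open>The factor 1/6 compensates for the six orderings of a face, so the right side is the sum
  over faces of squared image area divided by area.\<close>

lemma stretch_energy_eq:
  fixes v :: "'n::finite \<Rightarrow> real^3"
  assumes "simplicial_complex M" "simplicial_map M f" "nondegenerate_on_faces M v f"
  shows "stretch_energy M v f =
    1/6 * (\<Sum>i\<in>UNIV. \<Sum>j\<in>UNIV. \<Sum>k\<in>UNIV. face_weight M v i j k * (image_area v f i j k)\<^sup>2)"
proof -
  define u where "u i j k = face_weight M v i j k * image_area v f i j k" for i j k
  define q where "q i j k = f (v i) $ 1 * (f (v j) $ 2 - f (v k) $ 2) + f (v i) $ 2 * (f (v k) $ 1 - f (v j) $ 1)"
    for i j k
  have u: "u j k i = u i j k" for i j k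
    by (simp add: u_def face_weight_rotate[of M v j k i] image_area_rotate[of v f j k i])
  have cyc: "u i j k * q i j k + u j k i * q j k i + u k i j * q k i j =
      4 * (face_weight M v i j k * (image_area v f i j k)\<^sup>2)" for i j k
  proof -
    \<comment> \<open>By the shoelace formula, each of the two halves of \<open>q\<close> adds up
      cyclically to twice the area.\<close>
    have "q i j k + q j k i + q k i j = 4 * image_area v f i j k"
      by (simp add: q_def image_area_def signed_area_def algebra_simps)
    moreover have "u j k i = u i j k" "u k i j = u i j k" using u by metis+
    ultimately have "u i j k * q i j k + u j k i * q j k i + u k i j * q k i j = u i j k * (4 * image_area v f i j k)"
      by (metis distrib_left)
    then show ?thesis by (simp add: u_def power2_eq_square)
  qed
  have "stretch_energy M v f = 1/8 * (\<Sum>i\<in>UNIV. \<Sum>j\<in>UNIV. \<Sum>k\<in>UNIV. u i j k * q i j k)"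
  proof -
    have "f (v i) $ 1 * (stretch_laplacian M v f *v vertex_coords v f 1) $ i +
        f (v i) $ 2 * (stretch_laplacian M v f *v vertex_coords v f 2) $ i =
        1/4 * (\<Sum>j\<in>UNIV. \<Sum>k\<in>UNIV. u i j k * q i j k)" for i
      unfolding stretch_laplacian_coords[OF assms] u_def [symmetric] q_def distrib_left sum.distrib
      by (simp add: sum_distrib_left mult.left_commute)
    then have "(\<Sum>i\<in>UNIV. f (v i) $ 1 * (stretch_laplacian M v f *v vertex_coords v f 1) $ i +
        f (v i) $ 2 * (stretch_laplacian M v f *v vertex_coords v f 2) $ i) =
        1/4 * (\<Sum>i\<in>UNIV. \<Sum>j\<in>UNIV. \<Sum>k\<in>UNIV. u i j k * q i j k)"
      by (simp add: sum_distrib_left)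
    then show ?thesis
      by (simp add: stretch_energy_def inner_vec_def vertex_coords_def sum.distrib)
  qed
  also have "(\<Sum>i\<in>UNIV. \<Sum>j\<in>UNIV. \<Sum>k\<in>UNIV. u i j k * q i j k) =
      1/3 * (\<Sum>i\<in>UNIV. \<Sum>j\<in>UNIV. \<Sum>k\<in>UNIV. u i j k * q i j k + u j k i * q j k i + u k i j * q k i j)"
    by (rule sum_cyclic)
  finally show ?thesis by (simp add: cyc sum_distrib_left)
qed

section \<open>The gradient of the energy in coordinates\<close>

text \<open>The signed area as a function of the coordinate vectors alone, grouped so that each
  first coordinate multiplies a difference along the opposite edge.\<close>

definition coord_area :: "(real^'n) \<times> (real^'n) \<Rightarrow> 'n \<Rightarrow> 'n \<Rightarrow> 'n \<Rightarrow> real" where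
  "coord_area z i j k = 1/2 *
    (fst z $ i * (snd z $ j - snd z $ k) + fst z $ j * (snd z $ k - snd z $ i) + fst z $ k * (snd z $ i - snd z $ j))"

text \<open>The part of the derivative of \<open>2 * coord_area\<close> in direction \<open>h\<close> that comes from moving
  vertex \<open>i\<close>; the other two parts follow by rotating the indices.\<close>

definition coord_area_deriv ::
  "(real^'n) \<times> (real^'n) \<Rightarrow> (real^'n) \<times> (real^'n) \<Rightarrow> 'n \<Rightarrow> 'n \<Rightarrow> 'n \<Rightarrow> real" where
  "coord_area_deriv z h i j k =
     fst h $ i * (snd z $ j - snd z $ k) + snd h $ i * (fst z $ k - fst z $ j)"

lemma image_area_eq_coord_area:
  "image_area v f i j k = coord_area (vertex_coords v f 1, vertex_coords v f 2) i j k"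
  by (simp add: image_area_def signed_area_def coord_area_def vertex_coords_def algebra_simps)

lemma has_derivative_coord_area:
  "((\<lambda>z. coord_area z i j k) has_derivative
    (\<lambda>h. 1/2 * (coord_area_deriv z h i j k + coord_area_deriv z h j k i + coord_area_deriv z h k i j))) (at z)"
proof -
  note [derivative_intros] =
    bounded_linear_imp_has_derivative[OF bounded_linear_compose[OF bounded_linear_vec_nth bounded_linear_fst]]
    bounded_linear_imp_has_derivative[OF bounded_linear_compose[OF bounded_linear_vec_nth bounded_linear_snd]]
  show ?thesis
    unfolding coord_area_def coord_area_deriv_def
    by (rule derivative_eq_intros refl)+ (simp add: fun_eq_iff algebra_simps)
qed

lemma continuous_coord_area: "isCont (\<lambda>z. coord_area z i j k) z"
  using has_derivative_coord_area by (rule has_derivative_continuous)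

text \<open>Differentiating the area gives one part per corner. Weight and area are invariant under
  rotation, so the three parts contribute equally and can all be charged to vertex \<open>i\<close>,
  which turns 1/6 into 1/2.\<close>

lemma GDERIV_weighted_area_squares:
  fixes w :: "'n::finite \<Rightarrow> 'n \<Rightarrow> 'n \<Rightarrow> real"
  assumes w: "\<And>i j k. w j k i = w i j k"
  shows "GDERIV (\<lambda>z. 1/6 * (\<Sum>i\<in>UNIV. \<Sum>j\<in>UNIV. \<Sum>k\<in>UNIV. w i j k * (coord_area z i j k)\<^sup>2)) z :>
    ((\<chi> i. 1/2 * (\<Sum>j\<in>UNIV. \<Sum>k\<in>UNIV. w i j k * coord_area z i j k * (snd z $ j - snd z $ k))),
     (\<chi> i. 1/2 * (\<Sum>j\<in>UNIV. \<Sum>k\<in>UNIV. w i j k * coord_area z i j k * (fst z $ k - fst z $ j))))"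
    (is "GDERIV ?E z :> ?G")
proof -
  define u where "u i j k = w i j k * coord_area z i j k" for i j k
  define d where "d h i j k = coord_area_deriv z h i j k" for h i j k
  have area: "coord_area z j k i = coord_area z i j k" for i j k
    by (simp add: coord_area_def)
  have u1: "u j k i = u i j k" for i j k
    unfolding u_def by (rule arg_cong2[where f = "(*)", OF w area])
  have u2: "u k i j = u i j k" for i j k
    by (rule u1[symmetric])
  have "(?E has_derivative (\<lambda>h. 1/6 * (\<Sum>i\<in>UNIV. \<Sum>j\<in>UNIV. \<Sum>k\<in>UNIV.
      w i j k * (of_nat 2 * (1/2 * (d h i j k + d h j k i + d h k i j)) * coord_area z i j k ^ (2 - 1))))) (at z)"
    unfolding d_def
    by (intro has_derivative_mult_right has_derivative_sum has_derivative_power has_derivative_coord_area)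
  moreover have "1/6 * (\<Sum>i\<in>UNIV. \<Sum>j\<in>UNIV. \<Sum>k\<in>UNIV.
      w i j k * (of_nat 2 * (1/2 * (d h i j k + d h j k i + d h k i j)) * coord_area z i j k ^ (2 - 1))) = h \<bullet> ?G" for h
  proof -
    have "1/6 * (\<Sum>i\<in>UNIV. \<Sum>j\<in>UNIV. \<Sum>k\<in>UNIV.
        w i j k * (of_nat 2 * (1/2 * (d h i j k + d h j k i + d h k i j)) * coord_area z i j k ^ (2 - 1))) =
      1/2 * (1/3 * (\<Sum>i\<in>UNIV. \<Sum>j\<in>UNIV. \<Sum>k\<in>UNIV.
        u i j k * d h i j k + u j k i * d h j k i + u k i j * d h k i j))"
    proof -
      have "w i j k * (of_nat 2 * (1/2 * (d h i j k + d h j k i + d h k i j)) * coord_area z i j k ^ (2 - 1)) =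
          u i j k * d h i j k + u j k i * d h j k i + u k i j * d h k i j" for i j k
        unfolding u1[of j k i] u2[of k i j] u_def[of i j k] by (simp add: algebra_simps)
      then show ?thesis by (simp only:)
    qed
    also have "\<dots> = 1/2 * (\<Sum>i\<in>UNIV. \<Sum>j\<in>UNIV. \<Sum>k\<in>UNIV. u i j k * d h i j k)"
      by (rule arg_cong[OF sum_cyclic[of "\<lambda>i j k. u i j k * d h i j k", symmetric]])
    also have "\<dots> = h \<bullet> ?G"
    proof -
      \<comment> \<open>The components of the gradient are the coefficients of
        \<open>fst h $ i\<close> and \<open>snd h $ i\<close>.\<close>
      have "1/2 * (\<Sum>j\<in>UNIV. \<Sum>k\<in>UNIV. u i j k * d h i j k) =
          fst h $ i * fst ?G $ i + snd h $ i * snd ?G $ i" for i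
        unfolding d_def coord_area_deriv_def distrib_left sum.distrib u_def [symmetric]
        by (simp add: sum_distrib_left mult.left_commute)
      then have "(\<Sum>i\<in>UNIV. 1/2 * (\<Sum>j\<in>UNIV. \<Sum>k\<in>UNIV. u i j k * d h i j k)) =
          (\<Sum>i\<in>UNIV. fst h $ i * fst ?G $ i + snd h $ i * snd ?G $ i)"
        by (rule sum.cong[OF refl])
      then show ?thesis
        unfolding sum_distrib_left [symmetric] sum.distrib inner_prod_def inner_vec_def inner_real_def .
    qed
    finally show ?thesis .
  qed
  ultimately show ?thesis by (simp add: gderiv_def)
qed

section \<open>Transfer of the gradient to the stretch energy\<close>

text \<open>Finitely many continuous functions that are nonzero at a point stay nonzero near it. A
  derivative needs the energy formula at all nearby vertex images, not only at those of
  \<open>f\<close>.\<close>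

lemma eventually_nondegenerate:
  fixes v :: "'n::finite \<Rightarrow> real^3"
  assumes complex: "simplicial_complex M" and v: "bij_betw v UNIV (vertices M)"
    and nondeg: "nondegenerate_on_faces M v f"
  shows "\<forall>\<^sub>F z in nhds (vertex_coords v f 1, vertex_coords v f 2).
    nondegenerate_on_faces M v (simplicial_interp M v (fst z) (snd z))"
proof -
  have "\<forall>\<^sub>F z in nhds (vertex_coords v f 1, vertex_coords v f 2).
      \<forall>i\<in>UNIV. \<forall>j\<in>UNIV. \<forall>k\<in>UNIV. convex hull {v i, v j, v k} \<in> faces M \<longrightarrow> coord_area z i j k \<noteq> 0"
  proof (intro eventually_ball_finite finite ballI)
    fix i j k
    show "\<forall>\<^sub>F z in nhds (vertex_coords v f 1, vertex_coords v f 2).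
      convex hull {v i, v j, v k} \<in> faces M \<longrightarrow> coord_area z i j k \<noteq> 0"
    proof (cases "convex hull {v i, v j, v k} \<in> faces M")
      case True
      then have "coord_area (vertex_coords v f 1, vertex_coords v f 2) i j k \<noteq> 0"
        using nondeg by (simp add: nondegenerate_on_faces_def image_area_eq_coord_area)
      moreover have "((\<lambda>z. coord_area z i j k) \<longlongrightarrow>
          coord_area (vertex_coords v f 1, vertex_coords v f 2) i j k)
          (nhds (vertex_coords v f 1, vertex_coords v f 2))"
        using continuous_coord_area unfolding isCont_def
        by (rule tendsto_at_iff_tendsto_nhds[of "\<lambda>z. coord_area z i j k", THEN iffD1])
      ultimately have "\<forall>\<^sub>F z in nhds (vertex_coords v f 1, vertex_coords v f 2). coord_area z i j k \<noteq> 0"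
        by (metis tendsto_imp_eventually_ne)
      then show ?thesis by (rule eventually_mono) simp
    qed simp
  qed
  then show ?thesis
    by (rule eventually_mono)
      (simp add: nondegenerate_on_faces_def image_area_eq_coord_area simplicial_interp[OF complex v])
qed

lemma nondegenerate_on_facesI:
  assumes "simplicial_map M f" and "\<And>\<tau>. \<tau> \<in> faces M \<Longrightarrow> 2 simplex (f ` \<tau>)"
  shows "nondegenerate_on_faces M v f"
  unfolding nondegenerate_on_faces_def image_area_def
  using assms image_face signed_area_nonzero by metis

theorem corollary1:
  fixes M :: "(real^3) set set"
    and v :: "'n::finite \<Rightarrow> real^3"
    and f :: "real^3 \<Rightarrow> real^2"
    and h1 h2 :: "real^'n"
  assumes "simplicial_surface M"
    and "bij_betw v UNIV (vertices M)"
    and "simplicial_map M f"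
    and "\<And>\<tau>. \<tau> \<in> faces M \<Longrightarrow> 2 simplex (f ` \<tau>)"
    and "\<And>i. h1 $ i = 1/2 * (\<Sum>(j, k)\<in>ccw_faces_at M v f i.
                 area_ratio v f i j k * (f (v j) $ 2 - f (v k) $ 2))"
    and "\<And>i. h2 $ i = 1/2 * (\<Sum>(j, k)\<in>ccw_faces_at M v f i.
                 area_ratio v f i j k * (f (v k) $ 1 - f (v j) $ 1))"
  shows "h1 = stretch_laplacian M v f *v vertex_coords v f 1 \<and>
         h2 = stretch_laplacian M v f *v vertex_coords v f 2 \<and>
         (GDERIV (\<lambda>(x, y). stretch_energy M v (simplicial_interp M v x y))
            (vertex_coords v f 1, vertex_coords v f 2) :>
            2 *\<^sub>R (stretch_laplacian M v f *v vertex_coords v f 1,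
                  stretch_laplacian M v f *v vertex_coords v f 2))"
proof (intro conjI)
  have complex: "simplicial_complex M"
    using assms(1) by (simp add: simplicial_surface_def)
  have nondeg: "nondegenerate_on_faces M v f"
    using assms(3,4) by (rule nondegenerate_on_facesI)
  note L = stretch_laplacian_coords[OF complex assms(3) nondeg]
  \<comment> \<open>Coordinate differences are antisymmetric, as required of \<open>d\<close>; two
    factors 1/2 then match the 1/4 in \<open>L\<close>.\<close>
  note ccw = sum_ccw_faces_at[OF assms(3) nondeg]
  show "h1 = stretch_laplacian M v f *v vertex_coords v f 1"
    unfolding vec_eq_iff
    by (intro allI, unfold assms(5) L, subst ccw) simp_all
  show "h2 = stretch_laplacian M v f *v vertex_coords v f 2"
    unfolding vec_eq_iff
    by (intro allI, unfold assms(6) L, subst ccw) simp_all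
  \<comment> \<open>The polynomial that coincides with the stretch energy near the vertex images of
    \<open>f\<close>.\<close>
  define E where "E z = 1/6 * (\<Sum>i\<in>UNIV. \<Sum>j\<in>UNIV. \<Sum>k\<in>UNIV. face_weight M v i j k * (coord_area z i j k)\<^sup>2)"
    for z :: "(real^'n) \<times> (real^'n)"
  let ?z = "(vertex_coords v f 1, vertex_coords v f 2)"
  let ?G = "2 *\<^sub>R (stretch_laplacian M v f *v vertex_coords v f 1,
                  stretch_laplacian M v f *v vertex_coords v f 2)"
  have gradient: "?G = ((\<chi> i. 1/2 * (\<Sum>j\<in>UNIV. \<Sum>k\<in>UNIV. face_weight M v i j k * coord_area ?z i j k *
          (snd ?z $ j - snd ?z $ k))),
       (\<chi> i. 1/2 * (\<Sum>j\<in>UNIV. \<Sum>k\<in>UNIV. face_weight M v i j k * coord_area ?z i j k *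
          (fst ?z $ k - fst ?z $ j))))"
    by (simp add: vec_eq_iff L image_area_eq_coord_area [symmetric]) (simp add: vertex_coords_def)
  have grad_E: "GDERIV E ?z :> ?G"
    unfolding gradient unfolding E_def
    by (rule GDERIV_weighted_area_squares) (rule face_weight_rotate)
  have ev: "\<forall>\<^sub>F z in nhds ?z. E z = (\<lambda>(x, y). stretch_energy M v (simplicial_interp M v x y)) z"
    using eventually_nondegenerate[OF complex assms(2) nondeg]
  proof (rule eventually_mono)
    fix z assume "nondegenerate_on_faces M v (simplicial_interp M v (fst z) (snd z))"
    then have "stretch_energy M v (simplicial_interp M v (fst z) (snd z)) = E z"
      unfolding E_def
      by (simp add: stretch_energy_eq[OF complex] simplicial_interp[OF complex assms(2)] image_area_eq_coord_area)
    then show "E z = (\<lambda>(x, y). stretch_energy M v (simplicial_interp M v x y)) z"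
      by (simp add: case_prod_unfold)
  qed
  \<comment> \<open>The filter \<open>at ?z\<close> leaves out the point itself, so equality there
    is recorded separately.\<close>
  have at_z: "E ?z = (\<lambda>(x, y). stretch_energy M v (simplicial_interp M v x y)) ?z"
    using ev by (rule eventually_nhds_x_imp_x)
  have ev_at: "\<forall>\<^sub>F z in at ?z. E z = (\<lambda>(x, y). stretch_energy M v (simplicial_interp M v x y)) z"
    unfolding eventually_at_filter by (rule eventually_mono[OF ev]) (intro impI)
  show "GDERIV (\<lambda>(x, y). stretch_energy M v (simplicial_interp M v x y)) ?z :> ?G"
    unfolding gderiv_def
    by (rule has_derivative_transform_eventually[OF grad_E[unfolded gderiv_def] ev_at at_z UNIV_I])
qed

end
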